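(* Let $P_{(1,0,1,0)}$ be the set of all cylindric partitions with profile $c=(1,0,1,0)$. Then, as formal power series in $q$, $$\sum_{\Lambda\in P_{(1,0,1,0)}} q^{|\Lambda|}=\left(1+\sum_{n\ge1}\frac{2\,q^{n(n+1)}(-q^2;q^2)_{n-1}}{(q^2;q^2)_n\,(-q;q^2)_n}\right)\frac{(-q;q^2)_\infty}{(q;q)_\infty}.$$
   Context: Let $r,\ell$ be positive integers and $c=(c_1,\dots,c_r)$ a composition of $\ell$ into $r$ nonnegative integer parts (zero entries allowed). A cylindric partition with profile $c$ is a tuple $\Lambda=(\lambda^{(1)},\dots,\lambda^{(r)})$ of ordinary partitions $\lambda^{(i)}=(\lambda^{(i)}_1\ge\lambda^{(i)}_2\ge\cdots)$ (parts beyond the length are taken to be $0$) such that for all $i,j$: $\lambda^{(i)}_j\ge\lambda^{(i+1)}_{j+c_{i+1}}$ for $1\le i\le r-1$, and $\lambda^{(r)}_j\ge\lambda^{(1)}_{j+c_1}$. The size $|\Lambda|$ is the sum of all parts of all $\lambda^{(i)}$; the empty cylindric partition is included with size $0$. Notation: $(a;q)_n=\prod_{k=1}^n(1-aq^{k-1})$ (so $(a;q)_0=1$), $(a;q)_\infty=\lim_{n\to\infty}(a;q)_n$. *)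

theory Defs
  imports "HOL-Analysis.Analysis"
begin

section \<open>Cylindric partitions\<close>

text \<open>A partition is the weakly decreasing list of its positive parts.\<close>

definition is_partition :: "nat list \<Rightarrow> bool" where
  "is_partition xs \<longleftrightarrow> sorted_wrt (\<ge>) xs \<and> (\<forall>x\<in>set xs. 0 < x)"

text \<open>The parts $\lambda_1, \lambda_2, \ldots$ are numbered from 1;
  those beyond the length are 0.\<close>

definition part :: "nat list \<Rightarrow> nat \<Rightarrow> nat" where
  "part xs j = (if 1 \<le> j \<and> j \<le> length xs then xs ! (j - 1) else 0)"

text \<open>The profile $c$ and the tuple $\Lambda$ are lists of the same length $r$, indexed from 0, so
  that $c_{i+1}$ is \<open>c ! i\<close> and $\lambda^{(i+1)}$ is \<open>\<Lambda> ! i\<close>.\<close>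

definition cylindric_partition :: "nat list \<Rightarrow> nat list list \<Rightarrow> bool" where
  "cylindric_partition c \<Lambda> \<longleftrightarrow>
     length \<Lambda> = length c \<and>
     (\<forall>xs\<in>set \<Lambda>. is_partition xs) \<and>
     (\<forall>i j. i + 1 < length c \<longrightarrow> 1 \<le> j \<longrightarrow>
        part (\<Lambda> ! i) j \<ge> part (\<Lambda> ! (i + 1)) (j + c ! (i + 1))) \<and>
     (\<forall>j\<ge>1. part (\<Lambda> ! (length c - 1)) j \<ge> part (\<Lambda> ! 0) (j + c ! 0))"

definition cylindric_partitions :: "nat list \<Rightarrow> nat list list set" where
  "cylindric_partitions c = {\<Lambda>. cylindric_partition c \<Lambda>}"

definition cyl_size :: "nat list list \<Rightarrow> nat" where
  "cyl_size \<Lambda> = sum_list (map sum_list \<Lambda>)"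


section \<open>q-Pochhammer symbols of formal power series\<close>

definition qpoch :: "'a::comm_ring_1 \<Rightarrow> 'a \<Rightarrow> nat \<Rightarrow> 'a" where
  "qpoch a q n = (\<Prod>k=1..n. 1 - a * q ^ (k - 1))"

text \<open>The limit is taken in the metric topology of the formal power series, in which convergence
  means that every coefficient is eventually constant.\<close>

definition qpoch_inf :: "'a::comm_ring_1 fps \<Rightarrow> 'a fps \<Rightarrow> 'a fps" where
  "qpoch_inf a q = lim (\<lambda>n. qpoch a q n)"

lemma qpoch_Suc: "qpoch a q (Suc n) = qpoch a q n * (1 - a * q ^ n)"
  by (simp add: qpoch_def prod.nat_ivl_Suc' mult.commute)

lemma fps_nth_power_eq_0:
  fixes q :: "'a::comm_ring_1 fps"
  assumes "fps_nth q 0 = 0" "m < n"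
  shows "fps_nth (q ^ n) m = 0"
  using assms startsby_zero_power_prefix[of q n] by auto

lemma qpoch_tendsto:
  fixes a q :: "'a::comm_ring_1 fps"
  assumes "fps_nth q 0 = 0"
  shows "(\<lambda>n. qpoch a q n) \<longlonglongrightarrow> qpoch_inf a q"
proof -
  have step: "fps_nth (qpoch a q (Suc n)) m = fps_nth (qpoch a q n) m" if "m < n" for m n
  proof -
    have "fps_nth (qpoch a q n * a * q ^ n) m = 0"
      using that assms by (simp add: fps_mult_nth[of "qpoch a q n * a"] fps_nth_power_eq_0)
    then show ?thesis
      by (simp add: qpoch_Suc algebra_simps)
  qed
  have stable: "fps_nth (qpoch a q n) m = fps_nth (qpoch a q (Suc m)) m" if "Suc m \<le> n" for m n
    using that by (induction n rule: dec_induct) (simp_all add: step)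
  have "(\<lambda>n. qpoch a q n) \<longlonglongrightarrow> Abs_fps (\<lambda>m. fps_nth (qpoch a q (Suc m)) m)"
  proof (rule tendsto_fpsI)
    fix m
    show "\<forall>\<^sub>F n in sequentially. fps_nth (qpoch a q n) m = fps_nth (Abs_fps (\<lambda>m. fps_nth (qpoch a q (Suc m)) m)) m"
      using eventually_ge_at_top[of "Suc m"] by eventually_elim (simp, rule stable)
  qed
  then show ?thesis
    unfolding qpoch_inf_def using limI by metis
qed

lemma qpoch_nth_0:
  fixes a q :: "'a::comm_ring_1 fps"
  assumes "fps_nth a 0 = 0"
  shows "fps_nth (qpoch a q n) 0 = 1"
  by (induction n) (simp_all add: assms qpoch_Suc, simp add: qpoch_def)

lemma fps_X_power_multiples_summable:
  fixes F :: "nat \<Rightarrow> 'a::comm_ring_1 fps"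
  assumes "\<And>n. n \<in> A \<Longrightarrow> fps_X ^ n dvd F n"
  shows "F summable_on A"
proof -
  have van: "fps_nth (F n) m = 0" if "n \<in> A" "m < n" for n m
  proof -
    from assms[OF that(1)] obtain g where "F n = fps_X ^ n * g" ..
    with that show ?thesis by (simp add: fps_X_power_mult_nth)
  qed
  have *: "{n\<in>A. fps_nth (F n) m \<noteq> 0} \<subseteq> {..m}" for m
    using van[of _ m] by (auto intro: leI)
  have "(F has_sum Abs_fps (\<lambda>m. \<Sum>n | n \<in> A \<and> fps_nth (F n) m \<noteq> 0. fps_nth (F n) m)) A"
    by (rule has_sum_fpsI) (simp_all add: finite_subset[OF *])
  then show ?thesis
    by (auto simp: summable_on_def)
qed

text \<open>Convergence of the series on the right-hand side of the main identity.\<close>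

lemma rhs_summable:
  fixes q :: "rat fps"
  defines "q \<equiv> fps_X"
  shows "(\<lambda>n. 2 * q ^ (n * (n + 1)) * qpoch (- (q\<^sup>2)) (q\<^sup>2) (n - 1) /
            (qpoch (q\<^sup>2) (q\<^sup>2) n * qpoch (- q) (q\<^sup>2) n)) summable_on {1..}"
proof (rule fps_X_power_multiples_summable)
  fix n :: nat
  have unit: "fps_nth (qpoch (q\<^sup>2) (q\<^sup>2) n * qpoch (- q) (q\<^sup>2) n) 0 \<noteq> 0"
    using qpoch_nth_0[of "q\<^sup>2" "q\<^sup>2" n] qpoch_nth_0[of "- q" "q\<^sup>2" n]
    unfolding q_def by (simp only: fps_mult_nth_0) simp
  have "fps_X ^ n dvd q ^ (n * (n + 1))"
    unfolding q_def by (rule le_imp_power_dvd) simp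
  then show "fps_X ^ n dvd 2 * q ^ (n * (n + 1)) * qpoch (- (q\<^sup>2)) (q\<^sup>2) (n - 1) /
      (qpoch (q\<^sup>2) (q\<^sup>2) n * qpoch (- q) (q\<^sup>2) n)"
    unfolding fps_divide_unit[OF unit] by (intro dvd_mult2 dvd_mult)
qed

end

theory Submission
  imports Defs
begin

text \<open>
  Weight a cylindric partition $\Lambda$ by $q^{|\Lambda| + s \max\Lambda}$ and call the generating function
  $F_c(s)$; this is the two-variable function $F_c(z,q)$ of Corteel and Welsh at $z = q^s$. Removing
  the largest part from those $\lambda^{(i)}$, $i \in J$, that attain the maximum gives, by inclusion
  and exclusion over $J$, a linear system that expresses $F_c(s)$ by the $F_{c(J)}(s + |J|)$. For rank
  4 and level 2 there are three profiles up to rotation, and eliminating $(2,0,0,0)$ and $(1,1,0,0)$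
  shows that $G(s) = (q^{s+1};q)_\infty F_{(1,0,1,0)}(s)$ satisfies
  $$G(s) = (1 + q^{s+1} + q^{s+2})\, G(s+2) + q^{s+2} (1 - q^{s+3})\, G(s+4).$$
  Since $G(s) \equiv 1$ modulo $q^s$, this determines $G$. The series
  $$\sum_{n \ge 0} \frac{q^{n(n+1)} (-1;q^2)_n}{(q^2;q^2)_n}\, q^{sn} (-q^{s+2n+1};q^2)_\infty$$
  is another solution, by telescoping, and the claim is the case $s = 0$.
\<close>

section \<open>The topological ring of formal power series\<close>

text \<open>Continuity of the ring operations rests on this: coefficient \<open>n\<close> of a sum
  or product involves only coefficients up to \<open>n\<close>, and these are frozen near a
  point.\<close>

lemma eventually_nhds_fps_coeffs:
  fixes a :: "'a::group_add fps"
  shows "\<forall>\<^sub>F x in nhds a. \<forall>i\<le>n. fps_nth x i = fps_nth a i"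
proof -
  have "((\<lambda>x. x) \<longlongrightarrow> a) (nhds a)"
    by (rule filterlim_ident)
  then have "\<forall>\<^sub>F x in nhds a. \<forall>i\<in>{..n}. fps_nth x i = fps_nth a i"
    by (subst eventually_ball_finite_distrib) (auto simp: tendsto_fps_iff)
  then show ?thesis
    unfolding Ball_def atMost_iff .
qed

text \<open>The rules for splitting and adding infinite sums assume continuous addition; those for
  constant factors assume the continuous multiplication of the next instance.\<close>

instance fps :: (ab_group_add) topological_ab_group_add
proof
  fix a b :: "'a fps"
  show "((\<lambda>x. fst x + snd x) \<longlongrightarrow> a + b) (nhds a \<times>\<^sub>F nhds b)"
  proof (rule tendsto_fpsI)
    fix n
    have "\<forall>\<^sub>F (x, y) in nhds a \<times>\<^sub>F nhds b.
        (\<forall>i\<le>n. fps_nth x i = fps_nth a i) \<and> (\<forall>i\<le>n. fps_nth y i = fps_nth b i)"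
      using eventually_nhds_fps_coeffs[of n a] eventually_nhds_fps_coeffs[of n b]
      unfolding case_prod_unfold by (rule eventually_prodI)
    then show "\<forall>\<^sub>F x in nhds a \<times>\<^sub>F nhds b. fps_nth (fst x + snd x) n = fps_nth (a + b) n"
      by eventually_elim auto
  qed
  show "(uminus \<longlongrightarrow> - a) (nhds a)"
  proof (rule tendsto_fpsI)
    fix n
    show "\<forall>\<^sub>F x in nhds a. fps_nth (- x) n = fps_nth (- a) n"
      using eventually_nhds_fps_coeffs[of n a] by eventually_elim auto
  qed
qed

instance fps :: (ring) topological_semigroup_mult
proof
  fix a b :: "'a fps"
  show "((\<lambda>x. fst x * snd x) \<longlongrightarrow> a * b) (nhds a \<times>\<^sub>F nhds b)"
  proof (rule tendsto_fpsI)
    fix n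
    have "\<forall>\<^sub>F (x, y) in nhds a \<times>\<^sub>F nhds b.
        (\<forall>i\<le>n. fps_nth x i = fps_nth a i) \<and> (\<forall>i\<le>n. fps_nth y i = fps_nth b i)"
      using eventually_nhds_fps_coeffs[of n a] eventually_nhds_fps_coeffs[of n b]
      unfolding case_prod_unfold by (rule eventually_prodI)
    then show "\<forall>\<^sub>F x in nhds a \<times>\<^sub>F nhds b. fps_nth (fst x * snd x) n = fps_nth (a * b) n"
      by eventually_elim (auto simp: fps_mult_nth)
  qed
qed

lemma fps_X_power_dvd_iff:
  fixes f :: "'a::comm_ring_1 fps"
  shows "fps_X ^ k dvd f \<longleftrightarrow> (\<forall>i<k. fps_nth f i = 0)"
proof
  assume "fps_X ^ k dvd f"
  then show "\<forall>i<k. fps_nth f i = 0"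
    by (auto simp: fps_X_power_mult_nth)
next
  assume "\<forall>i<k. fps_nth f i = 0"
  then have "f = fps_X ^ k * fps_shift k f"
    by (intro fps_ext) (simp add: fps_X_power_mult_nth)
  then show "fps_X ^ k dvd f"
    by (rule dvdI)
qed

text \<open>The multiples of \<open>fps_X ^ k\<close> form a closed set, because each coefficient of
  a convergent family eventually equals that of the limit.\<close>

lemma fps_X_power_dvd_tendsto:
  fixes f :: "'b \<Rightarrow> 'a::comm_ring_1 fps"
  assumes "(f \<longlongrightarrow> l) F" "F \<noteq> bot" "\<forall>\<^sub>F x in F. fps_X ^ k dvd f x"
  shows "fps_X ^ k dvd l"
  unfolding fps_X_power_dvd_iff
proof (intro allI impI)
  fix i assume "i < k"
  have "\<forall>\<^sub>F x in F. fps_nth (f x) i = fps_nth l i"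
    using assms(1) by (simp add: tendsto_fps_iff)
  with assms(3) have "\<forall>\<^sub>F x in F. fps_nth l i = 0"
    by eventually_elim (use \<open>i < k\<close> in \<open>auto simp: fps_X_power_dvd_iff\<close>)
  with assms(2) show "fps_nth l i = 0"
    by simp
qed

lemma fps_X_power_dvd_infsum:
  fixes f :: "'b \<Rightarrow> 'a::comm_ring_1 fps"
  assumes "\<And>x. x \<in> A \<Longrightarrow> fps_X ^ k dvd f x"
  shows "fps_X ^ k dvd infsum f A"
proof (cases "f summable_on A")
  case True
  then have "(sum f \<longlongrightarrow> infsum f A) (finite_subsets_at_top A)"
    by (simp add: has_sum_def[symmetric])
  moreover have "\<forall>\<^sub>F S in finite_subsets_at_top A. fps_X ^ k dvd sum f S"
    by (rule eventually_finite_subsets_at_top_weakI) (use assms in \<open>auto intro: dvd_sum\<close>)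
  ultimately show ?thesis
    by (rule fps_X_power_dvd_tendsto[OF _ finite_subsets_at_top_neq_bot])
\<comment> \<open>A sum that does not exist is 0 by convention, and 0 is divisible.\<close>
qed (simp add: infsum_not_exists)

section \<open>Infinite q-Pochhammer products\<close>

lemma qpoch_Suc_shift: "qpoch a q (Suc n) = (1 - a) * qpoch (a * q) q n"
proof (induction n)
  case 0
  show ?case by (simp add: qpoch_def)
next
  case (Suc n)
  show ?case
    unfolding qpoch_Suc[of a q "Suc n"] Suc qpoch_Suc[of "a * q" q n] by (simp add: mult.assoc)
qed

lemma qpoch_inf_step:
  fixes a q :: "'a::comm_ring_1 fps"
  assumes "fps_nth q 0 = 0"
  shows "qpoch_inf a q = (1 - a) * qpoch_inf (a * q) q"
proof (rule LIMSEQ_unique)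
  show "(\<lambda>n. qpoch a q (Suc n)) \<longlonglongrightarrow> qpoch_inf a q"
    using qpoch_tendsto[OF assms] by (rule LIMSEQ_Suc)
  show "(\<lambda>n. qpoch a q (Suc n)) \<longlonglongrightarrow> (1 - a) * qpoch_inf (a * q) q"
    unfolding qpoch_Suc_shift by (intro tendsto_mult tendsto_const qpoch_tendsto assms)
qed

lemma qpoch_inf_split:
  fixes a q :: "'a::comm_ring_1 fps"
  assumes "fps_nth q 0 = 0"
  shows "qpoch_inf a q = qpoch a q n * qpoch_inf (a * q ^ n) q"
proof (induction n)
  case 0
  show ?case by (simp add: qpoch_def)
next
  case (Suc n)
  then show ?case
    using qpoch_inf_step[OF assms, of "a * q ^ n"] by (simp add: qpoch_Suc mult.assoc power_commutes)
qed

text \<open>Each factor is congruent to 1 modulo \<open>a\<close>, hence modulo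
  \<open>fps_X ^ k\<close>, and the congruence passes to the limit. This yields the normalization
  that singles out a solution of the recurrence.\<close>

lemma fps_X_power_dvd_qpoch_inf_minus_1:
  fixes a q :: "'a::comm_ring_1 fps"
  assumes "fps_nth q 0 = 0" "fps_X ^ k dvd a"
  shows "fps_X ^ k dvd qpoch_inf a q - 1"
proof (rule fps_X_power_dvd_tendsto)
  show "(\<lambda>n. qpoch a q n - 1) \<longlonglongrightarrow> qpoch_inf a q - 1"
    by (intro tendsto_diff tendsto_const qpoch_tendsto assms)
  have "fps_X ^ k dvd qpoch a q n - 1" for n
  proof (induction n)
    case 0
    show ?case by (simp add: qpoch_def)
  next
    case (Suc n)
    have "qpoch a q (Suc n) - 1 = (qpoch a q n - 1) - a * (qpoch a q n * q ^ n)"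
      by (simp add: qpoch_Suc algebra_simps)
    with Suc assms(2) show ?case
      by (metis dvd_diff dvd_mult2)
  qed
  then show "\<forall>\<^sub>F n in sequentially. fps_X ^ k dvd qpoch a q n - 1"
    by simp
qed simp

lemma qpoch_inf_nth_0:
  fixes a q :: "'a::comm_ring_1 fps"
  assumes "fps_nth q 0 = 0" "fps_nth a 0 = 0"
  shows "fps_nth (qpoch_inf a q) 0 = 1"
proof -
  have "fps_X ^ 1 dvd a"
    unfolding fps_X_power_dvd_iff using assms by simp
  from fps_X_power_dvd_qpoch_inf_minus_1[OF assms(1) this] show ?thesis
    unfolding fps_X_power_dvd_iff by simp
qed

section \<open>A q-difference equation\<close>

text \<open>The difference of two solutions satisfies the same linear recurrence. Modulo
  \<open>fps_X ^ N\<close> it vanishes for \<open>s \<ge> N\<close>, and the recurrence carries this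
  down to every \<open>s\<close>; as \<open>N\<close> is arbitrary, the difference is 0.\<close>

lemma q_difference_equation_unique:
  fixes G K u v :: "nat \<Rightarrow> 'a::comm_ring_1 fps"
  assumes "\<And>s. G s = u s * G (s + 2) + v s * G (s + 4)"
    and "\<And>s. K s = u s * K (s + 2) + v s * K (s + 4)"
    and "\<And>s. fps_X ^ s dvd G s - 1"
    and "\<And>s. fps_X ^ s dvd K s - 1"
  shows "G s = K s"
proof -
  have step: "fps_X ^ N dvd G s - K s" for N s
  \<comment> \<open>Truncated subtraction makes the measure 0 for all \<open>s \<ge> N\<close>;
    below that, \<open>s + 2\<close> and \<open>s + 4\<close> have smaller measure.\<close>
  proof (induction "N - s" arbitrary: s rule: less_induct)
    case less
    show ?case
    proof (cases "N \<le> s")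
      case True
      have "fps_X ^ s dvd (G s - 1) - (K s - 1)"
        using assms(3,4) by (rule dvd_diff)
      with le_imp_power_dvd[OF True, of fps_X] show ?thesis
        by (auto intro: dvd_trans)
    next
      case False
      have "G s - K s = u s * (G (s + 2) - K (s + 2)) + v s * (G (s + 4) - K (s + 4))"
        by (subst assms(1), subst assms(2)) (simp add: algebra_simps)
      moreover have "fps_X ^ N dvd G (s + 2) - K (s + 2)" "fps_X ^ N dvd G (s + 4) - K (s + 4)"
        using False by (intro less; simp)+
      ultimately show ?thesis
        by simp
    qed
  qed
  have "fps_nth (G s - K s) n = 0" for n
    using step[of "Suc n" s] unfolding fps_X_power_dvd_iff by blast
  then show ?thesis
    by (intro fps_ext) simp
qed

section \<open>The explicit solution as a series\<close>

abbreviation (input) q :: "rat fps" where "q \<equiv> fps_X"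

text \<open>The coefficients of the sum to be evaluated: since
  $2 (-q^2;q^2)_{n-1} = (-1;q^2)_n$ for $n \ge 1$, its term for $n = 0$ is 1.\<close>

definition series_coeff :: "nat \<Rightarrow> rat fps" where
  "series_coeff n = q ^ (n * (n + 1)) * qpoch (- 1) (q\<^sup>2) n * inverse (qpoch (q\<^sup>2) (q\<^sup>2) n)"

definition series_solution :: "nat \<Rightarrow> rat fps" where
  "series_solution s =
     (\<Sum>\<^sub>\<infinity>n. series_coeff n * q ^ (s * n) * qpoch_inf (- (q ^ (s + 2 * n + 1))) (q\<^sup>2))"

lemma fps_X_power_dvd_series_coeff: "q ^ n dvd series_coeff n"
  unfolding series_coeff_def mult.assoc by (intro dvd_mult2 le_imp_power_dvd) simp

text \<open>The cofactor \<open>h\<close> is arbitrary, so one rule covers all series below, with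
  their infinite products.\<close>

lemma series_coeff_summable: "(\<lambda>n. series_coeff n * h n) summable_on A"
  by (rule fps_X_power_multiples_summable) (intro dvd_mult2 fps_X_power_dvd_series_coeff)

lemma series_coeff_0: "series_coeff 0 = 1"
  by (simp add: series_coeff_def qpoch_def)

text \<open>The ratio of consecutive coefficients with its denominator cleared: the three factors
  come from the increment of \<open>n * (n + 1)\<close> and from the last factors of the two
  Pochhammer symbols.\<close>

lemma series_coeff_Suc:
  "series_coeff (Suc n) * (1 - q ^ (2 * n + 2)) = q ^ (2 * n + 2) * (1 + q ^ (2 * n)) * series_coeff n"
proof -
  define w where "w = 1 - q ^ (2 * n + 2)"
  define v where "v = qpoch (q\<^sup>2) (q\<^sup>2) n"
  have v0: "fps_nth v 0 \<noteq> 0"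
    unfolding v_def by (subst qpoch_nth_0) simp_all
  have w0: "fps_nth w 0 \<noteq> 0"
    by (simp add: w_def)
  have w: "inverse (qpoch (q\<^sup>2) (q\<^sup>2) (Suc n)) = inverse v * inverse w"
    by (simp add: qpoch_Suc v_def w_def fps_inverse_mult power_mult[symmetric] power_add[symmetric] add.commute)
  have m: "qpoch (- 1) (q\<^sup>2) (Suc n) = qpoch (- 1) (q\<^sup>2) n * (1 + q ^ (2 * n))"
    by (simp add: qpoch_Suc power_mult)
  have e: "q ^ (Suc n * (Suc n + 1)) = q ^ (2 * n + 2) * q ^ (n * (n + 1))"
    by (simp add: power_add[symmetric] algebra_simps)
  have "series_coeff (Suc n) * w =
      q ^ (2 * n + 2) * (1 + q ^ (2 * n)) * (q ^ (n * (n + 1)) * qpoch (- 1) (q\<^sup>2) n * inverse v) * (inverse w * w)"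
    unfolding series_coeff_def m e w by (simp only: mult_ac)
  then show ?thesis
    unfolding inverse_mult_eq_1[OF w0] by (simp only: w_def series_coeff_def v_def mult_1_right)
qed

text \<open>With \<open>z = q ^ s\<close>, the terms for \<open>s\<close>, \<open>s + 2\<close> and
  \<open>s + 4\<close> are \<open>A\<close>, \<open>B\<close> and \<open>C\<close>: raising
  \<open>s\<close> by 2 multiplies the power by \<open>q ^ (2 * n)\<close> and advances the product
  from \<open>P n\<close> to \<open>P (n + 1)\<close>.\<close>

lemma series_solution_recurrence:
  "series_solution s = (1 + q ^ (s + 1) + q ^ (s + 2)) * series_solution (s + 2)
     + q ^ (s + 2) * (1 - q ^ (s + 3)) * series_solution (s + 4)"
proof -
  define z where "z = q ^ s"
  define c where "c = series_coeff"
  define P where "P n = qpoch_inf (- (q ^ (s + 2 * n + 1))) (q\<^sup>2)" for n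
  \<comment> \<open>The telescoping certificate. Its factor \<open>1 - q ^ (2 * n)\<close> gives
    \<open>T 0 = 0\<close> and, in \<open>T (Suc n)\<close>, is the denominator cleared in
    \<open>series_coeff_Suc\<close>.\<close>
  define T where "T n = c n * (z ^ n * P (n + 1) * (1 - q ^ (2 * n)))" for n
  define A where "A n = c n * (z ^ n * P n)" for n
  define B where "B n = c n * (z ^ n * q ^ (2 * n) * P (n + 1))" for n
  define C where "C n = c n * (z ^ n * q ^ (4 * n) * P (n + 2))" for n
  have P: "P n = (1 + z * q ^ (2 * n + 1)) * P (n + 1)" for n
  proof -
    have "P n = (1 + q ^ (s + 2 * n + 1)) * qpoch_inf (- (q ^ (s + 2 * n + 1)) * q\<^sup>2) (q\<^sup>2)"
      unfolding P_def by (subst qpoch_inf_step) simp_all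
    also have "- (q ^ (s + 2 * n + 1)) * q\<^sup>2 = - (q ^ (s + 2 * (n + 1) + 1))"
      by (simp add: power_add power2_eq_square)
    also have "q ^ (s + 2 * n + 1) = z * q ^ (2 * n + 1)"
      by (simp add: z_def power_add)
    finally show ?thesis
      unfolding P_def .
  qed
  have sums: "A summable_on UNIV" "B summable_on UNIV" "C summable_on UNIV" "T summable_on UNIV"
    unfolding A_def B_def C_def T_def c_def by (intro series_coeff_summable)+
  have K: "series_solution s = infsum A UNIV" "series_solution (s + 2) = infsum B UNIV"
    "series_solution (s + 4) = infsum C UNIV"
  proof -
    have z: "q ^ (s * n) = z ^ n" "q ^ ((s + 2) * n) = z ^ n * q ^ (2 * n)"
        "q ^ ((s + 4) * n) = z ^ n * q ^ (4 * n)" for n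
      unfolding z_def power_mult[symmetric] power_add[symmetric] by (simp_all add: algebra_simps)
    have e: "s + 2 + 2 * n + 1 = s + 2 * (n + 1) + 1" "s + 4 + 2 * n + 1 = s + 2 * (n + 2) + 1" for n
      by simp_all
    show "series_solution s = infsum A UNIV" "series_solution (s + 2) = infsum B UNIV"
      "series_solution (s + 4) = infsum C UNIV"
      unfolding series_solution_def A_def B_def C_def P_def c_def z e by (simp_all only: mult.assoc)
  qed
  \<comment> \<open>The summands satisfy the recurrence up to a telescoping term that vanishes at both ends.\<close>
  have A: "A n = (1 + z * q + z * q^2) * B n + z * q^2 * (1 - z * q^3) * C n + (T n - T (Suc n))" for n
  proof -
    define y where "y = q ^ (2 * n)"
    have c: "c (Suc n) * (1 - y * q^2) = y * q^2 * (1 + y) * c n"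
      using series_coeff_Suc[of n] unfolding c_def y_def by (simp add: power_add power2_eq_square mult_ac)
    have T: "T (Suc n) = (y * q^2 * (1 + y) * c n) * (z ^ Suc n * P (n + 2))"
      unfolding c[symmetric] T_def by (simp add: y_def power2_eq_square mult_ac)
    have P1: "P (n + 1) = (1 + z * y * q^3) * P (n + 2)"
      using P[of "n + 1"] by (simp add: y_def power3_eq_cube mult_ac)
    have P0: "P n = (1 + z * y * q) * P (n + 1)"
      using P[of n] by (simp add: y_def mult_ac)
    have y4: "q ^ (4 * n) = y * y"
      by (simp add: y_def power_add[symmetric])
    \<comment> \<open>Everything is now a multiple of \<open>c n * z ^ n * P (n + 2)\<close>, which
      leaves a polynomial identity in \<open>y\<close>, \<open>z\<close> and
      \<open>q\<close>.\<close>
    show ?thesis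
      unfolding T unfolding A_def B_def C_def T_def P0 P1 y4 y_def[symmetric]
      by (simp add: algebra_simps power2_eq_square power3_eq_cube)
  qed
  have "((\<lambda>n. T n - T (Suc n)) has_sum 0) UNIV"
  proof -
    have T0: "T 0 = 0"
      by (simp add: T_def)
    \<comment> \<open>Since \<open>T 0 = 0\<close>, leaving out that term keeps the sum; reindexing
      by \<open>Suc\<close> then gives the shifted series the same value.\<close>
    have "((\<lambda>n. T (Suc n)) has_sum (infsum T UNIV)) UNIV"
    proof -
      have "(T has_sum (infsum T UNIV)) (range Suc)"
        using has_sum_infsum[OF sums(4)]
        by (rule has_sum_cong_neutral[THEN iffD1, rotated -1])
          (auto simp: image_iff intro: T0 dest: not0_implies_Suc, metis T0 not0_implies_Suc)
      then show ?thesis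
        by (subst (asm) has_sum_reindex) (auto simp: o_def)
    qed
    from has_sum_add[OF has_sum_infsum[OF sums(4)] has_sum_uminusI[OF this]] show ?thesis
      by simp
  qed
  then have "(A has_sum (1 + z * q + z * q^2) * infsum B UNIV + z * q^2 * (1 - z * q^3) * infsum C UNIV + 0) UNIV"
    unfolding A by (intro has_sum_add has_sum_cmult_right has_sum_infsum sums)
  then show ?thesis
    unfolding K unfolding power_add z_def[symmetric] by (simp add: infsumI mult.assoc)
qed

text \<open>The term for \<open>n = 0\<close> is an infinite product congruent to 1, and every later
  term contains \<open>q ^ (s * n)\<close> with \<open>n \<ge> 1\<close>.\<close>

lemma fps_X_power_dvd_series_solution: "q ^ s dvd series_solution s - 1"
proof -
  define F where "F n = series_coeff n * (q ^ (s * n) * qpoch_inf (- (q ^ (s + 2 * n + 1))) (q\<^sup>2))" for n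
  have "series_solution s = infsum F ({0} \<union> {1..})"
    unfolding series_solution_def F_def by (auto simp: mult.assoc intro!: arg_cong2[of _ _ _ _ infsum])
  also have "\<dots> = F 0 + infsum F {1..}"
    unfolding F_def by (subst infsum_Un_disjoint) (auto intro: series_coeff_summable)
  finally have *: "series_solution s - 1 = (qpoch_inf (- (q ^ (s + 1))) (q\<^sup>2) - 1) + infsum F {1..}"
    by (simp add: F_def series_coeff_0)
  have "q ^ s dvd qpoch_inf (- (q ^ (s + 1))) (q\<^sup>2) - 1"
    by (rule fps_X_power_dvd_qpoch_inf_minus_1) (simp_all add: le_imp_power_dvd)
  moreover have "q ^ s dvd infsum F {1..}"
    unfolding F_def by (intro fps_X_power_dvd_infsum dvd_mult dvd_mult2 le_imp_power_dvd) auto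
  ultimately show ?thesis
    unfolding * by (rule dvd_add)
qed

text \<open>At \<open>s = 0\<close> the infinite product in term \<open>n\<close> is the tail of
  \<open>qpoch_inf (- q) (q\<^sup>2)\<close> after \<open>n\<close> factors, so the full product can
  be pulled out, leaving the inverse of \<open>qpoch (- q) (q\<^sup>2) n\<close>.\<close>

lemma series_solution_0:
  "series_solution 0 = (1 + (\<Sum>\<^sub>\<infinity>n\<in>{1..}. 2 * q ^ (n * (n + 1)) * qpoch (- (q\<^sup>2)) (q\<^sup>2) (n - 1) /
       (qpoch (q\<^sup>2) (q\<^sup>2) n * qpoch (- q) (q\<^sup>2) n))) * qpoch_inf (- q) (q\<^sup>2)"
proof -
  define P where "P = qpoch_inf (- q) (q\<^sup>2)"
  define F where "F n = series_coeff n * inverse (qpoch (- q) (q\<^sup>2) n)" for n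
  have P: "qpoch_inf (- (q ^ (2 * n + 1))) (q\<^sup>2) = inverse (qpoch (- q) (q\<^sup>2) n) * P" for n
  proof -
    have "P = qpoch (- q) (q\<^sup>2) n * qpoch_inf (- (q ^ (2 * n + 1))) (q\<^sup>2)"
      unfolding P_def by (subst qpoch_inf_split[where n = n]) (simp_all add: power_mult)
    moreover have "inverse (qpoch (- q) (q\<^sup>2) n) * qpoch (- q) (q\<^sup>2) n = 1"
      by (rule inverse_mult_eq_1) (subst qpoch_nth_0; simp)
    ultimately show ?thesis
      by (simp add: mult.assoc[symmetric])
  qed
  have "series_solution 0 = (\<Sum>\<^sub>\<infinity>n. F n * P)"
    unfolding series_solution_def F_def add_0 P by (simp add: mult.assoc)
  also have "\<dots> = infsum F ({0} \<union> {1..}) * P"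
    unfolding F_def by (subst infsum_cmult_left) (auto intro: series_coeff_summable intro!: arg_cong2[of _ _ _ _ infsum])
  also have "infsum F ({0} \<union> {1..}) = F 0 + infsum F {1..}"
    unfolding F_def by (subst infsum_Un_disjoint) (auto intro: series_coeff_summable)
  also have "F 0 = 1"
    by (simp add: F_def series_coeff_0 qpoch_def)
  also have "infsum F {1..} = (\<Sum>\<^sub>\<infinity>n\<in>{1..}. 2 * q ^ (n * (n + 1)) * qpoch (- (q\<^sup>2)) (q\<^sup>2) (n - 1) /
       (qpoch (q\<^sup>2) (q\<^sup>2) n * qpoch (- q) (q\<^sup>2) n))"
  proof (rule infsum_cong)
    fix n :: nat assume "n \<in> {1..}"
    then obtain m where n: "n = Suc m"
      by (cases n) auto
    have unit: "fps_nth (qpoch (q\<^sup>2) (q\<^sup>2) n * qpoch (- q) (q\<^sup>2) n) 0 \<noteq> 0"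
      using qpoch_nth_0[of "q\<^sup>2" "q\<^sup>2" n] qpoch_nth_0[of "- q" "q\<^sup>2" n]
      by (simp only: fps_mult_nth_0) simp
    have "qpoch (- 1) (q\<^sup>2) n = 2 * qpoch (- (q\<^sup>2)) (q\<^sup>2) (n - 1)"
      by (simp add: n qpoch_Suc_shift)
    then show "F n = 2 * q ^ (n * (n + 1)) * qpoch (- (q\<^sup>2)) (q\<^sup>2) (n - 1) /
        (qpoch (q\<^sup>2) (q\<^sup>2) n * qpoch (- q) (q\<^sup>2) n)"
      unfolding fps_divide_unit[OF unit] F_def series_coeff_def by (simp add: fps_inverse_mult mult_ac)
  qed
  finally show ?thesis
    by (simp only: P_def)
qed

section \<open>Decomposing cylindric partitions\<close>

definition bounded_by :: "nat \<Rightarrow> nat list \<Rightarrow> bool" where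
  "bounded_by m xs \<longleftrightarrow> (\<forall>x\<in>set xs. x \<le> m)"

text \<open>Prepending a part 0 leaves a partition unchanged, because partitions are lists of positive parts.\<close>

definition pcons :: "nat \<Rightarrow> nat list \<Rightarrow> nat list" where
  "pcons m xs = (if m = 0 then xs else m # xs)"

text \<open>One link of the cyclic chain of conditions: \<open>k\<close> is the profile entry
  belonging to \<open>ys\<close>, the successor of \<open>xs\<close>.\<close>

definition dominates :: "nat \<Rightarrow> nat list \<Rightarrow> nat list \<Rightarrow> bool" where
  "dominates k xs ys \<longleftrightarrow> (\<forall>j\<ge>1. part ys (j + k) \<le> part xs j)"

lemma is_partition_Nil [simp]: "is_partition []"
  by (simp add: is_partition_def)

lemma is_partition_Cons:
  "is_partition (x # xs) \<longleftrightarrow> 0 < x \<and> bounded_by x xs \<and> is_partition xs"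
  by (auto simp: is_partition_def bounded_by_def)

lemma part_Nil [simp]: "part [] j = 0"
  by (simp add: part_def)

lemma part_Cons_Suc_0 [simp]: "part (x # xs) (Suc 0) = x"
  by (simp add: part_def)

lemma part_Cons_Suc: "part (x # xs) (Suc j) = (if j = 0 then x else part xs j)"
  by (cases j) (auto simp: part_def)

lemma part_le: "bounded_by m xs \<Longrightarrow> part xs j \<le> m"
  by (auto simp: part_def bounded_by_def intro: nth_mem)

lemma bounded_by_iff_part:
  assumes "is_partition xs"
  shows "bounded_by m xs \<longleftrightarrow> part xs 1 \<le> m"
  using assms by (cases xs) (auto simp: is_partition_Cons bounded_by_def)

lemma bounded_by_0: "is_partition xs \<Longrightarrow> bounded_by 0 xs \<longleftrightarrow> xs = []"
  by (cases xs) (auto simp: is_partition_Cons bounded_by_def)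

lemma is_partition_pcons: "is_partition xs \<Longrightarrow> bounded_by m xs \<Longrightarrow> is_partition (pcons m xs)"
  by (simp add: pcons_def is_partition_Cons)

lemma part_pcons_1:
  "is_partition xs \<Longrightarrow> bounded_by m xs \<Longrightarrow> part (pcons m xs) (Suc 0) = m"
  by (auto simp: pcons_def bounded_by_0)

lemma part_pcons_Suc:
  "is_partition xs \<Longrightarrow> bounded_by m xs \<Longrightarrow> part (pcons m xs) (Suc (Suc j)) = part xs (Suc j)"
  by (auto simp: pcons_def bounded_by_0 part_Cons_Suc)

lemma sum_list_pcons: "sum_list (pcons m xs) = m + sum_list xs"
  by (simp add: pcons_def)

text \<open>For \<open>m = 0\<close> the partition has to be empty, and
  \<open>tl [] = []\<close>.\<close>

lemma tl_pcons: "is_partition xs \<Longrightarrow> bounded_by m xs \<Longrightarrow> tl (pcons m xs) = xs"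
  by (auto simp: pcons_def bounded_by_0)

lemma pcons_tl: "is_partition xs \<Longrightarrow> pcons (part xs 1) (tl xs) = xs"
  by (cases xs) (auto simp: pcons_def is_partition_Cons)

lemma is_partition_tl: "is_partition xs \<Longrightarrow> is_partition (tl xs)"
  by (cases xs) (auto simp: is_partition_Cons)

lemma bounded_by_tl: "bounded_by m xs \<Longrightarrow> bounded_by m (tl xs)"
  by (cases xs) (auto simp: bounded_by_def)

lemma dominates_altdef: "dominates k xs ys \<longleftrightarrow> (\<forall>j. part ys (Suc (j + k)) \<le> part xs (Suc j))"
  unfolding dominates_def by (metis One_nat_def Suc_le_D add_Suc le_add1 plus_1_eq_Suc)

lemma all_nat_split: "(\<forall>j. P j) \<longleftrightarrow> P 0 \<and> (\<forall>j. P (Suc j))"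
  by (metis not0_implies_Suc)

text \<open>A prepended part shifts the indices of its partition by one, which the change from
  \<open>k\<close> to \<open>k'\<close> compensates. When \<open>xs\<close> is extended, one extra
  inequality with right-hand side \<open>m\<close> arises; it holds because all parts are at most
  \<open>m\<close>.\<close>

lemma dominates_pcons_iff:
  assumes "is_partition xs" "is_partition ys" "bounded_by m xs" "bounded_by m ys"
    and "k' + of_bool B = k + of_bool A"
  shows "dominates k (if A then pcons m xs else xs) (if B then pcons m ys else ys)
    \<longleftrightarrow> dominates k' xs ys"
proof -
  note part_simps = part_pcons_1[OF assms(1,3)] part_pcons_1[OF assms(2,4)]
    part_pcons_Suc[OF assms(1,3)] part_pcons_Suc[OF assms(2,4)]
  consider "A" "B" "k' = k" | "A" "\<not> B" "k' = Suc k" | "\<not> A" "B" "k = Suc k'" | "\<not> A" "\<not> B" "k' = k"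
    using assms(5) by (cases A; cases B) auto
  then show ?thesis
  proof cases
    case 1
    have "part (pcons m ys) (Suc k) \<le> m"
      using part_simps part_le[OF assms(4)] by (cases k) simp_all
    with 1 show ?thesis
      unfolding dominates_altdef by (subst all_nat_split) (simp add: part_simps)
  next
    case 2
    then show ?thesis
      unfolding dominates_altdef by (subst all_nat_split) (simp add: part_simps part_le[OF assms(4)])
  next
    case 3
    then show ?thesis
      unfolding dominates_altdef by (simp add: part_simps)
  qed simp
qed

text \<open>Indices modulo \<open>length c\<close> turn the wrap-around condition into an ordinary
  instance, so that all conditions can be treated alike.\<close>

lemma cylindric_partition_iff:
  assumes "0 < length c"
  shows "cylindric_partition c \<Lambda> \<longleftrightarrow> length \<Lambda> = length c \<and> (\<forall>i<length c. is_partition (\<Lambda> ! i)) \<and>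
    (\<forall>i<length c. dominates (c ! (Suc i mod length c)) (\<Lambda> ! i) (\<Lambda> ! (Suc i mod length c)))"
proof -
  have "(\<forall>i<length c. dominates (c ! (Suc i mod length c)) (\<Lambda> ! i) (\<Lambda> ! (Suc i mod length c)))
    \<longleftrightarrow> (\<forall>i. i + 1 < length c \<longrightarrow> dominates (c ! (i + 1)) (\<Lambda> ! i) (\<Lambda> ! (i + 1))) \<and>
        dominates (c ! 0) (\<Lambda> ! (length c - 1)) (\<Lambda> ! 0)" (is "?L \<longleftrightarrow> ?R")
  proof
    assume L: ?L
    show ?R
    proof (intro conjI allI impI)
      fix i assume "i + 1 < length c"
      with L[rule_format, of i] show "dominates (c ! (i + 1)) (\<Lambda> ! i) (\<Lambda> ! (i + 1))"
        by simp
    next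
      show "dominates (c ! 0) (\<Lambda> ! (length c - 1)) (\<Lambda> ! 0)"
        using L[rule_format, of "length c - 1"] assms by simp
    qed
  next
    assume R: ?R
    show ?L
    proof (intro allI impI)
      fix i assume "i < length c"
      then consider "Suc i < length c" | "Suc i = length c"
        by linarith
      then show "dominates (c ! (Suc i mod length c)) (\<Lambda> ! i) (\<Lambda> ! (Suc i mod length c))"
      proof cases
        case 2
        then have "i = length c - 1" by simp
        with 2 R show ?thesis by simp
      qed (use R in simp)
    qed
  qed
  then show ?thesis
    unfolding cylindric_partition_def dominates_def by (auto simp: all_set_conv_all_nth)
qed

section \<open>The largest part and the indices that attain it\<close>

definition cyl_max :: "nat list list \<Rightarrow> nat" where
  "cyl_max \<Lambda> = Max ((\<lambda>xs. part xs 1) ` set \<Lambda>)"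

text \<open>The second component remembers the value of the removed parts: what remains may have a
  smaller maximum, and only the bound \<open>m\<close> survives.\<close>

definition bounded_cylindric_partitions :: "nat list \<Rightarrow> (nat list list \<times> nat) set" where
  "bounded_cylindric_partitions c =
     {(\<Lambda>, m). \<Lambda> \<in> cylindric_partitions c \<and> (\<forall>xs\<in>set \<Lambda>. bounded_by m xs)}"

lemma cyl_max_le_iff:
  assumes "0 < length c" "\<Lambda> \<in> cylindric_partitions c"
  shows "cyl_max \<Lambda> \<le> m \<longleftrightarrow> (\<forall>xs\<in>set \<Lambda>. bounded_by m xs)"
proof -
  have "\<Lambda> \<noteq> []" "\<forall>xs\<in>set \<Lambda>. is_partition xs"
    using assms by (auto simp: cylindric_partitions_def cylindric_partition_def)
  then show ?thesis
    unfolding cyl_max_def by (subst Max_le_iff) (auto simp: bounded_by_iff_part)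
qed

lemma part_1_le_cyl_max: "i < length \<Lambda> \<Longrightarrow> part (\<Lambda> ! i) 1 \<le> cyl_max \<Lambda>"
  unfolding cyl_max_def by (intro Max_ge) auto

lemma cyl_max_attained:
  assumes "\<Lambda> \<noteq> []"
  obtains i where "i < length \<Lambda>" "part (\<Lambda> ! i) 1 = cyl_max \<Lambda>"
proof -
  have "cyl_max \<Lambda> \<in> (\<lambda>xs. part xs 1) ` set \<Lambda>"
    unfolding cyl_max_def using assms by (intro Max_in) auto
  then show ?thesis
    using that by (auto simp: in_set_conv_nth)
qed

definition attaining :: "nat list \<Rightarrow> nat set \<Rightarrow> nat list list set" where
  "attaining c J = {\<Lambda> \<in> cylindric_partitions c. \<forall>i\<in>J. part (\<Lambda> ! i) 1 = cyl_max \<Lambda>}"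

text \<open>If $c_{i+1} = 0$, then $\lambda^{(i)}_1 \ge \lambda^{(i+1)}_1$, so going backwards from an
  index where the maximum is attained leads to one with a positive entry of the profile.\<close>

lemma attaining_cover:
  assumes "k < length c" "0 < c ! k"
  shows "cylindric_partitions c = (\<Union>i\<in>{i. i < length c \<and> 0 < c ! i}. attaining c {i})"
proof (intro equalityI subsetI)
  fix \<Lambda> assume \<Lambda>: "\<Lambda> \<in> cylindric_partitions c"
  let ?r = "length c"
  have r: "0 < ?r" "length \<Lambda> = ?r" "\<Lambda> \<noteq> []"
    using assms \<Lambda> by (auto simp: cylindric_partitions_def cylindric_partition_def)
  have dom: "dominates (c ! (Suc i mod ?r)) (\<Lambda> ! i) (\<Lambda> ! (Suc i mod ?r))" if "i < ?r" for i
    using \<Lambda> r(1) that by (simp add: cylindric_partitions_def cylindric_partition_iff)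
  have "\<exists>i<?r. 0 < c ! i \<and> part (\<Lambda> ! i) 1 = cyl_max \<Lambda>"
  proof (rule ccontr)
    assume none: "\<not> ?thesis"
    \<comment> \<open>A walk forwards from \<open>k\<close>: at a zero entry the first part is at
      most its predecessor, and at a positive entry \<open>none\<close> excludes the
      maximum.\<close>
    have below: "part (\<Lambda> ! ((k + j) mod ?r)) 1 < cyl_max \<Lambda>" for j
    proof (induction j)
      case 0
      then show ?case
        using none assms part_1_le_cyl_max[of k \<Lambda>] r by (auto simp: order_le_less)
    next
      case (Suc j)
      define i where "i = (k + j) mod ?r"
      have i: "i < ?r" "(k + Suc j) mod ?r = Suc i mod ?r" "Suc i mod ?r < ?r"
        using r by (auto simp: i_def mod_Suc_eq)
      show ?case
      proof (cases "c ! (Suc i mod ?r) = 0")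
        case True
        then have "part (\<Lambda> ! (Suc i mod ?r)) 1 \<le> part (\<Lambda> ! i) 1"
          using dom[OF i(1)] unfolding dominates_def by (metis add.right_neutral order_refl)
        with Suc show ?thesis
          unfolding i(2) i_def[symmetric] by simp
      next
        case False
        then have "part (\<Lambda> ! (Suc i mod ?r)) 1 \<noteq> cyl_max \<Lambda>"
          using none i(3) by blast
        with part_1_le_cyl_max[of "Suc i mod ?r" \<Lambda>] i(3) r(2) show ?thesis
          unfolding i(2) by simp
      qed
    qed
    obtain i where i: "i < ?r" "part (\<Lambda> ! i) 1 = cyl_max \<Lambda>"
      using cyl_max_attained[OF r(3)] r(2) by auto
    \<comment> \<open>The number of forward steps from \<open>k\<close> to \<open>i\<close>, plus
      possibly a full turn.\<close>
    have "(k + (i + (?r - k))) mod ?r = i"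
      using i(1) assms(1) by simp
    with below[of "i + (?r - k)"] i show False
      by simp
  qed
  with \<Lambda> show "\<Lambda> \<in> (\<Union>i\<in>{i. i < length c \<and> 0 < c ! i}. attaining c {i})"
    by (auto simp: attaining_def)
qed (auto simp: attaining_def)

section \<open>Removing and restoring the largest parts\<close>

definition prepend :: "nat set \<Rightarrow> nat \<Rightarrow> nat list list \<Rightarrow> nat list list" where
  "prepend J m \<Lambda> = map (\<lambda>i. if i \<in> J then pcons m (\<Lambda> ! i) else \<Lambda> ! i) [0..<length \<Lambda>]"

definition behead :: "nat set \<Rightarrow> nat list list \<Rightarrow> nat list list" where
  "behead J \<Lambda> = map (\<lambda>i. if i \<in> J then tl (\<Lambda> ! i) else \<Lambda> ! i) [0..<length \<Lambda>]"

lemma length_prepend [simp]: "length (prepend J m \<Lambda>) = length \<Lambda>"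
  by (simp add: prepend_def)

lemma length_behead [simp]: "length (behead J \<Lambda>) = length \<Lambda>"
  by (simp add: behead_def)

lemma nth_prepend:
  "i < length \<Lambda> \<Longrightarrow> prepend J m \<Lambda> ! i = (if i \<in> J then pcons m (\<Lambda> ! i) else \<Lambda> ! i)"
  by (simp add: prepend_def)

lemma nth_behead:
  "i < length \<Lambda> \<Longrightarrow> behead J \<Lambda> ! i = (if i \<in> J then tl (\<Lambda> ! i) else \<Lambda> ! i)"
  by (simp add: behead_def)

lemma cyl_size_altdef: "cyl_size \<Lambda> = (\<Sum>i<length \<Lambda>. sum_list (\<Lambda> ! i))"
  by (simp add: cyl_size_def sum_list_sum_nth atLeast0LessThan)

lemma cyl_size_prepend:
  assumes "J \<subseteq> {..<length \<Lambda>}"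
  shows "cyl_size (prepend J m \<Lambda>) = cyl_size \<Lambda> + card J * m"
proof -
  have "cyl_size (prepend J m \<Lambda>) = (\<Sum>i<length \<Lambda>. sum_list (\<Lambda> ! i) + (if i \<in> J then m else 0))"
    by (auto simp: cyl_size_altdef nth_prepend sum_list_pcons intro!: sum.cong)
  also have "\<dots> = cyl_size \<Lambda> + card J * m"
    using assms by (simp add: sum.distrib cyl_size_altdef sum.If_cases Int_absorb1)
  finally show ?thesis .
qed

text \<open>Used with positive \<open>s\<close>: for \<open>s = 0\<close>, infinitely many bounds
  \<open>m\<close> of the same \<Lambda> would have equal weight.\<close>

definition bounded_gf :: "nat list \<Rightarrow> nat \<Rightarrow> rat fps" where
  "bounded_gf c s = (\<Sum>\<^sub>\<infinity>(\<Lambda>, m)\<in>bounded_cylindric_partitions c. q ^ (cyl_size \<Lambda> + s * m))"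

text \<open>In the notation of Corteel and Welsh the profile \<open>c'\<close> is $c(J)$; the condition relating it
  to \<open>c\<close> is stated without subtraction.\<close>

lemma attaining_gf:
  fixes s :: nat
  assumes J: "J \<noteq> {}" "J \<subseteq> {..<length c}" and len: "length c' = length c"
    and c': "\<And>i. i < length c \<Longrightarrow>
      c' ! (Suc i mod length c) + of_bool (Suc i mod length c \<in> J) = c ! (Suc i mod length c) + of_bool (i \<in> J)"
  shows "(\<Sum>\<^sub>\<infinity>\<Lambda>\<in>attaining c J. q ^ (cyl_size \<Lambda> + s * cyl_max \<Lambda>)) =
    bounded_gf c' (s + card J)"
proof -
  define r where "r = length c"
  have r: "0 < r"
    using J by (auto simp: r_def)
  have Suc_mod: "Suc i mod r < r" for i
    using r by simp
  have bnd: "(\<Lambda>, m) \<in> bounded_cylindric_partitions c' \<longleftrightarrow> length \<Lambda> = r \<and>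
      (\<forall>i<r. is_partition (\<Lambda> ! i) \<and> bounded_by m (\<Lambda> ! i)) \<and>
      (\<forall>i<r. dominates (c' ! (Suc i mod r)) (\<Lambda> ! i) (\<Lambda> ! (Suc i mod r)))" for \<Lambda> m
    using r len unfolding bounded_cylindric_partitions_def cylindric_partitions_def
    by (auto simp: cylindric_partition_iff r_def all_set_conv_all_nth)
  have att: "\<Lambda> \<in> cylindric_partitions c \<longleftrightarrow> length \<Lambda> = r \<and> (\<forall>i<r. is_partition (\<Lambda> ! i)) \<and>
      (\<forall>i<r. dominates (c ! (Suc i mod r)) (\<Lambda> ! i) (\<Lambda> ! (Suc i mod r)))" for \<Lambda>
    using r by (simp add: cylindric_partitions_def cylindric_partition_iff r_def)
  have dom: "dominates (c ! (Suc i mod r)) (prepend J m \<Lambda> ! i) (prepend J m \<Lambda> ! (Suc i mod r)) \<longleftrightarrow>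
      dominates (c' ! (Suc i mod r)) (\<Lambda> ! i) (\<Lambda> ! (Suc i mod r))"
    if "length \<Lambda> = r" "\<forall>i<r. is_partition (\<Lambda> ! i) \<and> bounded_by m (\<Lambda> ! i)" "i < r" for \<Lambda> m i
    using that Suc_mod[of i] c'[folded r_def, of i]
    by (simp only: nth_prepend) (rule dominates_pcons_iff; simp)
  have max: "cyl_max (prepend J m \<Lambda>) = m"
    if \<Lambda>: "length \<Lambda> = r" "\<forall>i<r. is_partition (\<Lambda> ! i) \<and> bounded_by m (\<Lambda> ! i)" for \<Lambda> m
  proof (rule antisym)
    obtain i where "i < r" "part (prepend J m \<Lambda> ! i) 1 = cyl_max (prepend J m \<Lambda>)"
      using cyl_max_attained[of "prepend J m \<Lambda>"] \<Lambda>(1) r by (metis length_prepend length_greater_0_conv)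
    with \<Lambda> show "cyl_max (prepend J m \<Lambda>) \<le> m"
      using part_le[of m "\<Lambda> ! i" 1] part_pcons_1[of "\<Lambda> ! i" m] by (auto simp: nth_prepend split: if_splits)
    \<comment> \<open>As \<open>J\<close> is nonempty, some prepended part really attains
      \<open>m\<close>.\<close>
    obtain j where "j \<in> J" "j < r"
      using J by (auto simp: r_def)
    with \<Lambda> show "m \<le> cyl_max (prepend J m \<Lambda>)"
      using part_1_le_cyl_max[of j "prepend J m \<Lambda>"] part_pcons_1[of "\<Lambda> ! j" m] by (simp add: nth_prepend)
  qed
  have inv: "behead J (prepend J m \<Lambda>) = \<Lambda>"
    if "length \<Lambda> = r" "\<forall>i<r. is_partition (\<Lambda> ! i) \<and> bounded_by m (\<Lambda> ! i)" for \<Lambda> m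
    using that by (intro nth_equalityI) (auto simp: nth_behead nth_prepend tl_pcons)
  have behead: "length (behead J \<Lambda>) = r"
      "\<forall>i<r. is_partition (behead J \<Lambda> ! i) \<and> bounded_by (cyl_max \<Lambda>) (behead J \<Lambda> ! i)"
      "prepend J (cyl_max \<Lambda>) (behead J \<Lambda>) = \<Lambda>"
    if \<Lambda>: "\<Lambda> \<in> attaining c J" for \<Lambda>
  proof -
    have cyl: "\<Lambda> \<in> cylindric_partitions c" and eq: "\<And>i. i \<in> J \<Longrightarrow> part (\<Lambda> ! i) 1 = cyl_max \<Lambda>"
      using \<Lambda> by (auto simp: attaining_def)
    have \<Lambda>': "length \<Lambda> = r" "\<And>i. i < r \<Longrightarrow> is_partition (\<Lambda> ! i)"
      using cyl by (auto simp: att)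
    have bdd: "bounded_by (cyl_max \<Lambda>) (\<Lambda> ! i)" if "i < r" for i
      using part_1_le_cyl_max[of i \<Lambda>] \<Lambda>' that by (simp add: bounded_by_iff_part)
    show "length (behead J \<Lambda>) = r"
      by (simp add: \<Lambda>')
    show "\<forall>i<r. is_partition (behead J \<Lambda> ! i) \<and> bounded_by (cyl_max \<Lambda>) (behead J \<Lambda> ! i)"
      using \<Lambda>' bdd by (auto simp: nth_behead is_partition_tl bounded_by_tl)
    show "prepend J (cyl_max \<Lambda>) (behead J \<Lambda>) = \<Lambda>"
    proof (rule nth_equalityI)
      fix i assume "i < length (prepend J (cyl_max \<Lambda>) (behead J \<Lambda>))"
      then show "prepend J (cyl_max \<Lambda>) (behead J \<Lambda>) ! i = \<Lambda> ! i"
        using \<Lambda>' eq[of i] pcons_tl[of "\<Lambda> ! i"] by (cases "i \<in> J") (simp_all add: nth_behead nth_prepend)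
    qed simp
  qed
  show ?thesis
    unfolding bounded_gf_def
  proof (rule infsum_reindex_bij_witness[where i = "\<lambda>(\<Lambda>, m). prepend J m \<Lambda>" and
        j = "\<lambda>\<Lambda>. (behead J \<Lambda>, cyl_max \<Lambda>)"])
    fix \<Lambda> assume \<Lambda>: "\<Lambda> \<in> attaining c J"
    note b = behead[OF \<Lambda>]
    show "(case (behead J \<Lambda>, cyl_max \<Lambda>) of (\<Lambda>, m) \<Rightarrow> prepend J m \<Lambda>) = \<Lambda>"
      by (simp add: b)
    show "(behead J \<Lambda>, cyl_max \<Lambda>) \<in> bounded_cylindric_partitions c'"
      unfolding bnd using b(1,2) dom[OF b(1,2)] \<Lambda> unfolding b(3) by (simp add: attaining_def att)
    \<comment> \<open>Removal lowers the size by \<open>card J * cyl_max \<Lambda>\<close>, and this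
      is absorbed by the shift from \<open>s\<close> to \<open>s + card J\<close>.\<close>
    show "(case (behead J \<Lambda>, cyl_max \<Lambda>) of (\<Lambda>, m) \<Rightarrow> q ^ (cyl_size \<Lambda> + (s + card J) * m)) =
        q ^ (cyl_size \<Lambda> + s * cyl_max \<Lambda>)"
      using cyl_size_prepend[of J "behead J \<Lambda>" "cyl_max \<Lambda>"] J(2) b(1)
      unfolding b(3) by (simp add: r_def algebra_simps)
  next
    fix p assume p: "p \<in> bounded_cylindric_partitions c'"
    obtain \<Lambda> m where pe: "p = (\<Lambda>, m)"
      by (cases p)
    have \<Lambda>: "length \<Lambda> = r" "\<forall>i<r. is_partition (\<Lambda> ! i) \<and> bounded_by m (\<Lambda> ! i)"
        "\<forall>i<r. dominates (c' ! (Suc i mod r)) (\<Lambda> ! i) (\<Lambda> ! (Suc i mod r))"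
      using p unfolding pe bnd by auto
    show "(behead J (case p of (\<Lambda>, m) \<Rightarrow> prepend J m \<Lambda>), cyl_max (case p of (\<Lambda>, m) \<Rightarrow> prepend J m \<Lambda>)) = p"
      using \<Lambda>(1,2) by (simp add: pe inv max)
    have "part (prepend J m \<Lambda> ! i) 1 = m" if "i \<in> J" for i
      using that J(2) \<Lambda>(1,2) part_pcons_1[of "\<Lambda> ! i" m] by (auto simp: nth_prepend r_def)
    moreover have "prepend J m \<Lambda> \<in> cylindric_partitions c"
      unfolding att using \<Lambda> dom[OF \<Lambda>(1,2)] by (auto simp: nth_prepend is_partition_pcons)
    ultimately show "(case p of (\<Lambda>, m) \<Rightarrow> prepend J m \<Lambda>) \<in> attaining c J"
      using max[OF \<Lambda>(1,2)] by (auto simp: pe attaining_def)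
  qed
qed

section \<open>Generating functions\<close>

text \<open>Finite fibres of \<open>w\<close> mean that only finitely many terms contribute to each
  coefficient.\<close>

lemma power_fps_X_summable:
  fixes w :: "'b \<Rightarrow> nat"
  assumes "\<And>n. finite {x \<in> A. w x = n}"
  shows "(\<lambda>x. (fps_X :: 'a::comm_ring_1 fps) ^ w x) summable_on A"
proof -
  have "finite {x \<in> A. fps_nth ((fps_X :: 'a fps) ^ w x) n \<noteq> 0}" for n
    by (rule finite_subset[OF _ assms[of n]]) (auto simp: fps_X_power_iff split: if_splits)
  then have "((\<lambda>x. (fps_X :: 'a fps) ^ w x) has_sum
      Abs_fps (\<lambda>n. \<Sum>x | x \<in> A \<and> fps_nth ((fps_X :: 'a fps) ^ w x) n \<noteq> 0. fps_nth (fps_X ^ w x) n)) A"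
    by (intro has_sum_fpsI) simp_all
  then show ?thesis
    by (rule has_sum_imp_summable)
qed

lemma length_le_sum_list: "is_partition xs \<Longrightarrow> length xs \<le> sum_list xs"
  by (induction xs) (auto simp: is_partition_Cons)

text \<open>Positive parts with total at most \<open>n\<close> bound both the entries and the
  lengths of the lists by \<open>n\<close>.\<close>

lemma finite_cylindric_partitions_of_size_le: "finite {\<Lambda> \<in> cylindric_partitions c. cyl_size \<Lambda> \<le> n}"
proof (rule finite_subset)
  show "finite {\<Lambda>. set \<Lambda> \<subseteq> {xs. set xs \<subseteq> {..n} \<and> length xs \<le> n} \<and> length \<Lambda> = length c}"
    by (intro finite_lists_length_eq finite_lists_length_le) simp
  show "{\<Lambda> \<in> cylindric_partitions c. cyl_size \<Lambda> \<le> n}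
    \<subseteq> {\<Lambda>. set \<Lambda> \<subseteq> {xs. set xs \<subseteq> {..n} \<and> length xs \<le> n} \<and> length \<Lambda> = length c}"
  proof safe
    fix \<Lambda> xs assume \<Lambda>: "\<Lambda> \<in> cylindric_partitions c" "cyl_size \<Lambda> \<le> n" "xs \<in> set \<Lambda>"
    then have sum: "sum_list xs \<le> n"
      using member_le_sum_list[of "sum_list xs" "map sum_list \<Lambda>"] by (auto simp: cyl_size_def)
    have "is_partition xs"
      using \<Lambda> by (auto simp: cylindric_partitions_def cylindric_partition_def)
    then show "length xs \<le> n"
      using length_le_sum_list[of xs] sum by linarith
    show "x \<le> n" if "x \<in> set xs" for x
      using member_le_sum_list[OF that] sum by linarith
  qed (auto simp: cylindric_partitions_def cylindric_partition_def)
qed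

definition cyl_gf :: "nat list \<Rightarrow> nat \<Rightarrow> rat fps" where
  "cyl_gf c s = (\<Sum>\<^sub>\<infinity>\<Lambda>\<in>cylindric_partitions c. q ^ (cyl_size \<Lambda> + s * cyl_max \<Lambda>))"

lemma cyl_gf_summable:
  assumes "A \<subseteq> cylindric_partitions c"
  shows "(\<lambda>\<Lambda>. q ^ (cyl_size \<Lambda> + s * cyl_max \<Lambda>)) summable_on A"
proof (rule power_fps_X_summable)
  fix n
  show "finite {\<Lambda> \<in> A. cyl_size \<Lambda> + s * cyl_max \<Lambda> = n}"
    by (rule finite_subset[OF _ finite_cylindric_partitions_of_size_le[of c n]]) (use assms in auto)
qed

lemma bounded_gf_summable:
  assumes "0 < s" "A \<subseteq> bounded_cylindric_partitions c"
  shows "(\<lambda>(\<Lambda>, m). q ^ (cyl_size \<Lambda> + s * m)) summable_on A"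
proof -
  have "finite {p \<in> A. cyl_size (fst p) + s * snd p = n}" for n
  proof (rule finite_subset)
    show "finite ({\<Lambda> \<in> cylindric_partitions c. cyl_size \<Lambda> \<le> n} \<times> {..n})"
      by (simp add: finite_cylindric_partitions_of_size_le)
    show "{p \<in> A. cyl_size (fst p) + s * snd p = n} \<subseteq> {\<Lambda> \<in> cylindric_partitions c. cyl_size \<Lambda> \<le> n} \<times> {..n}"
    proof safe
      fix \<Lambda> m assume *: "(\<Lambda>, m) \<in> A" "n = cyl_size (fst (\<Lambda>, m)) + s * snd (\<Lambda>, m)"
      then show "\<Lambda> \<in> cylindric_partitions c"
        using assms by (auto simp: bounded_cylindric_partitions_def)
      have "m \<le> s * m"
        using assms(1) by simp
      then show "m \<le> cyl_size (fst (\<Lambda>, m)) + s * snd (\<Lambda>, m)"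
        by (simp only: prod.sel trans_le_add2)
    qed simp
  qed
  then show ?thesis
    unfolding case_prod_unfold by (rule power_fps_X_summable)
qed

text \<open>The bound \<open>m\<close> either equals the maximum or exceeds it. Pairs of the first
  kind give \<open>cyl_gf c s\<close>; those of the second arise from all pairs by raising
  \<open>m\<close> by one, which multiplies the weight by \<open>q ^ s\<close>.\<close>

lemma bounded_gf_eq:
  assumes "0 < s" "0 < length c"
  shows "(1 - q ^ s) * bounded_gf c s = cyl_gf c s"
proof -
  let ?f = "\<lambda>(\<Lambda>, m). q ^ (cyl_size \<Lambda> + s * m)"
  let ?B = "bounded_cylindric_partitions c"
  let ?I = "(\<lambda>\<Lambda>. (\<Lambda>, cyl_max \<Lambda>)) ` cylindric_partitions c"
  let ?S = "(\<lambda>(\<Lambda>, m). (\<Lambda>, Suc m)) ` ?B"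
  have B: "?B = {(\<Lambda>, m). \<Lambda> \<in> cylindric_partitions c \<and> cyl_max \<Lambda> \<le> m}"
    unfolding bounded_cylindric_partitions_def using cyl_max_le_iff[OF assms(2)] by auto
  have sub: "?I \<subseteq> ?B" "?S \<subseteq> ?B"
    unfolding B by auto
  have un: "?B = ?I \<union> ?S"
  proof (rule equalityI)
    show "?B \<subseteq> ?I \<union> ?S"
    proof
      fix p assume "p \<in> ?B"
      then obtain \<Lambda> m where p: "p = (\<Lambda>, m)" "\<Lambda> \<in> cylindric_partitions c" "cyl_max \<Lambda> \<le> m"
        unfolding B by auto
      show "p \<in> ?I \<union> ?S"
      proof (cases "cyl_max \<Lambda> = m")
        case True
        with p show ?thesis by auto
      next
        case False
        with p obtain m' where "m = Suc m'" "cyl_max \<Lambda> \<le> m'"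
          by (cases m) auto
        with p have "(\<Lambda>, m') \<in> ?B" "p = (\<lambda>(\<Lambda>, m). (\<Lambda>, Suc m)) (\<Lambda>, m')"
          unfolding B by auto
        then show ?thesis by blast
      qed
    qed
  qed (use sub in blast)
  have "bounded_gf c s = infsum ?f ?I + infsum ?f ?S"
    unfolding bounded_gf_def
    by (subst un, rule infsum_Un_disjoint)
      (use sub assms(1) in \<open>auto intro!: bounded_gf_summable[of s _ c] simp: B\<close>)
  also have "infsum ?f ?I = cyl_gf c s"
    unfolding cyl_gf_def by (subst infsum_reindex) (auto simp: inj_on_def o_def)
  also have "infsum ?f ?S = (\<Sum>\<^sub>\<infinity>p\<in>?B. q ^ s * ?f p)"
    by (subst infsum_reindex) (auto simp: inj_on_def power_add mult_ac intro!: infsum_cong)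
  also have "\<dots> = q ^ s * bounded_gf c s"
    unfolding bounded_gf_def
    by (intro infsum_cmult_right bounded_gf_summable[of _ _ c] assms subset_refl)
  finally show ?thesis
    by (simp add: algebra_simps)
qed

section \<open>Invariance under rotation of the profile\<close>

lemma cylindric_partition_rotate1:
  "cylindric_partition (rotate1 c) (rotate1 \<Lambda>) \<longleftrightarrow> cylindric_partition c \<Lambda>"
proof (cases "length \<Lambda> = length c \<and> 0 < length c")
  case True
  define r where "r = length c"
  have r: "0 < r" "length c = r" "length \<Lambda> = r"
    using True by (auto simp: r_def)
  \<comment> \<open>The cyclic shift is onto; index 0 is reached from \<open>r - 1\<close>.\<close>
  have bij: "(\<forall>i<r. P (Suc i mod r)) \<longleftrightarrow> (\<forall>i<r. P i)" for P
  proof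
    assume L: "\<forall>i<r. P (Suc i mod r)"
    show "\<forall>i<r. P i"
    proof (intro allI impI)
      fix i assume "i < r"
      with L[rule_format, of "r - 1"] L[rule_format, of "i - 1"] show "P i"
        by (cases i) auto
    qed
  qed (use r in simp)
  have "cylindric_partition (rotate1 c) (rotate1 \<Lambda>) \<longleftrightarrow>
      (\<forall>i<r. is_partition (\<Lambda> ! (Suc i mod r))) \<and>
      (\<forall>i<r. dominates (c ! (Suc (Suc i mod r) mod r)) (\<Lambda> ! (Suc i mod r)) (\<Lambda> ! (Suc (Suc i mod r) mod r)))"
    using r by (simp add: cylindric_partition_iff nth_rotate1)
  also have "\<dots> \<longleftrightarrow> (\<forall>i<r. is_partition (\<Lambda> ! i)) \<and>
      (\<forall>i<r. dominates (c ! (Suc i mod r)) (\<Lambda> ! i) (\<Lambda> ! (Suc i mod r)))"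
    by (subst (1 2) bij[symmetric]) (rule refl)
  also have "\<dots> \<longleftrightarrow> cylindric_partition c \<Lambda>"
    using r by (simp add: cylindric_partition_iff)
  finally show ?thesis .
next
  case False
  then show ?thesis
    by (cases "length \<Lambda> = length c") (auto simp: cylindric_partition_def)
qed

lemma cylindric_partitions_rotate1:
  "cylindric_partitions (rotate1 c) = rotate1 ` cylindric_partitions c"
proof (intro equalityI subsetI)
  fix \<Lambda> assume "\<Lambda> \<in> cylindric_partitions (rotate1 c)"
  moreover have "\<Lambda> = rotate1 (rotate (length \<Lambda> - 1) \<Lambda>)"
  proof (cases \<Lambda>)
    case (Cons a as)
    then show ?thesis
      using rotate_id[of "length \<Lambda>" \<Lambda>] by (simp add: rotate_def)
  qed simp
  ultimately show "\<Lambda> \<in> rotate1 ` cylindric_partitions c"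
    using cylindric_partition_rotate1 by (metis (mono_tags) cylindric_partitions_def imageI mem_Collect_eq)
qed (auto simp: cylindric_partitions_def cylindric_partition_rotate1)

lemma cyl_gf_rotate1: "cyl_gf (rotate1 c) s = cyl_gf c s"
proof -
  have "inj_on rotate1 (cylindric_partitions c)"
    using inj_rotate1 by (rule inj_on_subset) simp
  moreover have "cyl_size (rotate1 \<Lambda>) = cyl_size \<Lambda>" "cyl_max (rotate1 \<Lambda>) = cyl_max \<Lambda>" for \<Lambda>
    by (cases \<Lambda>; simp add: cyl_size_def cyl_max_def)+
  ultimately show ?thesis
    unfolding cyl_gf_def cylindric_partitions_rotate1 by (subst infsum_reindex) (simp_all add: o_def)
qed

lemma replicate_Nil_cylindric_partition:
  assumes "0 < length c"
  shows "replicate (length c) [] \<in> cylindric_partitions c"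
  using assms by (simp add: cylindric_partitions_def cylindric_partition_iff dominates_def)

text \<open>Only the tuple of empty partitions has maximum 0. It contributes 1, and every other
  weight contains at least one factor \<open>q ^ s\<close>.\<close>

lemma fps_X_power_dvd_cyl_gf:
  assumes "0 < length c"
  shows "q ^ s dvd cyl_gf c s - 1"
proof -
  let ?f = "\<lambda>\<Lambda>. q ^ (cyl_size \<Lambda> + s * cyl_max \<Lambda>)"
  let ?E = "replicate (length c) []"
  let ?A = "cylindric_partitions c - {?E}"
  have "cyl_gf c s = infsum ?f ({?E} \<union> ?A)"
    using replicate_Nil_cylindric_partition[OF assms] by (simp add: cyl_gf_def insert_absorb)
  also have "\<dots> = infsum ?f {?E} + infsum ?f ?A"
    by (rule infsum_Un_disjoint) (auto intro: cyl_gf_summable)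
  also have "infsum ?f {?E} = 1"
    using assms by (simp add: cyl_size_def cyl_max_def sum_list_replicate)
  finally have *: "cyl_gf c s - 1 = infsum ?f ?A"
    by simp
  show ?thesis
    unfolding *
  proof (rule fps_X_power_dvd_infsum)
    fix \<Lambda> assume \<Lambda>: "\<Lambda> \<in> ?A"
    have "cyl_max \<Lambda> \<noteq> 0"
    proof
      assume "cyl_max \<Lambda> = 0"
      with \<Lambda> have "\<forall>xs\<in>set \<Lambda>. bounded_by 0 xs"
        using cyl_max_le_iff[OF assms, of \<Lambda> 0] by simp
      with \<Lambda> have "\<forall>xs\<in>set \<Lambda>. xs = []" "length \<Lambda> = length c"
        by (auto simp: cylindric_partitions_def cylindric_partition_def bounded_by_0)
      then have "\<Lambda> = ?E"
        by (metis replicate_length_same)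
      with \<Lambda> show False
        by simp
    qed
    then show "q ^ s dvd ?f \<Lambda>"
      by (intro le_imp_power_dvd) (simp add: trans_le_add2)
  qed
qed

section \<open>The linear system for rank 4 and level 2\<close>

text \<open>Two indices are enough, since a profile of level 2 has at most two positive
  entries.\<close>

lemma cyl_gf_inclusion_exclusion:
  assumes "cylindric_partitions c = attaining c {i} \<union> attaining c {j}"
  defines "f s \<equiv> \<lambda>\<Lambda>. q ^ (cyl_size \<Lambda> + s * cyl_max \<Lambda>)"
  shows "cyl_gf c s = infsum (f s) (attaining c {i}) + infsum (f s) (attaining c {j})
    - infsum (f s) (attaining c {i, j})"
proof -
  have "attaining c {i} \<inter> attaining c {j} = attaining c {i, j}"
    by (auto simp: attaining_def)
  then show ?thesis
    unfolding cyl_gf_def assms(1) f_def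
    by (subst infsum_Un_Int) (auto intro!: cyl_gf_summable[of _ c] simp: attaining_def)
qed

text \<open>The new profiles here and below follow one rule: each index in \<open>J\<close> passes
  one unit of its entry to the cyclically next index.\<close>

lemma cyl_gf_2000: "cyl_gf [2, 0, 0, 0] s = bounded_gf [1, 1, 0, 0] (s + 1)"
proof -
  let ?c = "[2, 0, 0, 0] :: nat list"
  have "{i. i < length ?c \<and> 0 < ?c ! i} = {0}"
    by (auto simp: less_Suc_eq)
  with attaining_cover[of 0 ?c] have "cylindric_partitions ?c = attaining ?c {0}"
    by simp
  moreover have "(\<Sum>\<^sub>\<infinity>\<Lambda>\<in>attaining ?c {0}. q ^ (cyl_size \<Lambda> + s * cyl_max \<Lambda>)) =
      bounded_gf [1, 1, 0, 0] (s + card {0::nat})"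
    by (rule attaining_gf) (auto simp: less_Suc_eq)
  ultimately show ?thesis
    by (simp add: cyl_gf_def)
qed

lemma cyl_gf_1100:
  "cyl_gf [1, 1, 0, 0] s =
     bounded_gf [0, 2, 0, 0] (s + 1) + bounded_gf [1, 0, 1, 0] (s + 1) - bounded_gf [0, 1, 1, 0] (s + 2)"
proof -
  let ?c = "[1, 1, 0, 0] :: nat list"
  let ?f = "\<lambda>\<Lambda>. q ^ (cyl_size \<Lambda> + s * cyl_max \<Lambda>)"
  have "{i. i < length ?c \<and> 0 < ?c ! i} = {0, 1}"
    by (auto simp: less_Suc_eq)
  with attaining_cover[of 0 ?c] have "cylindric_partitions ?c = attaining ?c {0} \<union> attaining ?c {1}"
    by simp
  note cyl_gf_inclusion_exclusion[OF this, of s]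
  moreover have "infsum ?f (attaining ?c {0}) = bounded_gf [0, 2, 0, 0] (s + card {0::nat})"
    by (rule attaining_gf) (auto simp: less_Suc_eq)
  moreover have "infsum ?f (attaining ?c {1}) = bounded_gf [1, 0, 1, 0] (s + card {1::nat})"
    by (rule attaining_gf) (auto simp: less_Suc_eq)
  moreover have "infsum ?f (attaining ?c {0, 1}) = bounded_gf [0, 1, 1, 0] (s + card {0, 1::nat})"
    by (rule attaining_gf) (auto simp: less_Suc_eq)
  ultimately show ?thesis
    by simp
qed

lemma cyl_gf_1010:
  "cyl_gf [1, 0, 1, 0] s =
     bounded_gf [0, 1, 1, 0] (s + 1) + bounded_gf [1, 0, 0, 1] (s + 1) - bounded_gf [0, 1, 0, 1] (s + 2)"
proof -
  let ?c = "[1, 0, 1, 0] :: nat list"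
  let ?f = "\<lambda>\<Lambda>. q ^ (cyl_size \<Lambda> + s * cyl_max \<Lambda>)"
  have "{i. i < length ?c \<and> 0 < ?c ! i} = {0, 2}"
    by (auto simp: less_Suc_eq)
  with attaining_cover[of 0 ?c] have "cylindric_partitions ?c = attaining ?c {0} \<union> attaining ?c {2}"
    by simp
  note cyl_gf_inclusion_exclusion[OF this, of s]
  moreover have "infsum ?f (attaining ?c {0}) = bounded_gf [0, 1, 1, 0] (s + card {0::nat})"
    by (rule attaining_gf) (auto simp: less_Suc_eq)
  moreover have "infsum ?f (attaining ?c {2}) = bounded_gf [1, 0, 0, 1] (s + card {2::nat})"
    by (rule attaining_gf) (auto simp: less_Suc_eq)
  moreover have "infsum ?f (attaining ?c {0, 2}) = bounded_gf [0, 1, 0, 1] (s + card {0, 2::nat})"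
    by (rule attaining_gf) (auto simp: less_Suc_eq)
  ultimately show ?thesis
    by simp
qed

text \<open>This is \<open>G(s)\<close> of the overview, taken for every profile. The prefactor
  absorbs the denominator \<open>1 - q ^ s\<close> introduced by \<open>bounded_gf_eq\<close>, and
  at \<open>s = 0\<close> it is the denominator \<open>qpoch_inf q q\<close> of the claim.\<close>

definition normalized_gf :: "nat list \<Rightarrow> nat \<Rightarrow> rat fps" where
  "normalized_gf c s = qpoch_inf (q ^ (s + 1)) q * cyl_gf c s"

lemma qpoch_inf_power_step: "qpoch_inf (q ^ s) q = (1 - q ^ s) * qpoch_inf (q ^ (s + 1)) q"
  by (subst qpoch_inf_step) (simp_all add: mult.commute)

lemma normalized_gf_rotate1: "normalized_gf (rotate1 c) s = normalized_gf c s"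
  by (simp add: normalized_gf_def cyl_gf_rotate1)

lemma normalized_bounded_gf:
  assumes "0 < length c"
  shows "qpoch_inf (q ^ (s + 1)) q * bounded_gf c (s + 1) = normalized_gf c (s + 1)"
    and "qpoch_inf (q ^ (s + 1)) q * bounded_gf c (s + 2) = (1 - q ^ (s + 1)) * normalized_gf c (s + 2)"
proof -
  have 1: "qpoch_inf (q ^ (t + 1)) q * bounded_gf c (t + 1) = normalized_gf c (t + 1)" for t
  proof -
    have "normalized_gf c (t + 1) = qpoch_inf (q ^ (t + 1 + 1)) q * ((1 - q ^ (t + 1)) * bounded_gf c (t + 1))"
      unfolding normalized_gf_def by (subst bounded_gf_eq) (use assms in simp_all)
    then show ?thesis
      unfolding qpoch_inf_power_step[of "t + 1"] by (simp only: mult_ac)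
  qed
  show "qpoch_inf (q ^ (s + 1)) q * bounded_gf c (s + 1) = normalized_gf c (s + 1)"
    by (rule 1)
  have "s + 1 + 1 = s + 2"
    by simp
  with 1[of "s + 1"]
  show "qpoch_inf (q ^ (s + 1)) q * bounded_gf c (s + 2) = (1 - q ^ (s + 1)) * normalized_gf c (s + 2)"
    unfolding qpoch_inf_power_step[of "s + 1"] by (simp only: mult.assoc)
qed

lemma normalized_gf_system:
  shows "normalized_gf [2, 0, 0, 0] s = normalized_gf [1, 1, 0, 0] (s + 1)"
    and "normalized_gf [1, 1, 0, 0] s = normalized_gf [2, 0, 0, 0] (s + 1)
      + normalized_gf [1, 0, 1, 0] (s + 1) - (1 - q ^ (s + 1)) * normalized_gf [1, 1, 0, 0] (s + 2)"
    and "normalized_gf [1, 0, 1, 0] s = 2 * normalized_gf [1, 1, 0, 0] (s + 1)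
      - (1 - q ^ (s + 1)) * normalized_gf [1, 0, 1, 0] (s + 2)"
proof -
  \<comment> \<open>Every profile on the right-hand sides is a rotation of one of three
    representatives, so the system closes.\<close>
  have rot: "normalized_gf [0, 2, 0, 0] t = normalized_gf [2, 0, 0, 0] t"
    "normalized_gf [0, 1, 1, 0] t = normalized_gf [1, 1, 0, 0] t"
    "normalized_gf [1, 0, 0, 1] t = normalized_gf [1, 1, 0, 0] t"
    "normalized_gf [0, 1, 0, 1] t = normalized_gf [1, 0, 1, 0] t" for t
    using normalized_gf_rotate1[of "[0, 2, 0, 0]" t] normalized_gf_rotate1[of "[0, 1, 1, 0]" t]
      normalized_gf_rotate1[of "[1, 1, 0, 0]" t] normalized_gf_rotate1[of "[0, 1, 0, 1]" t] by simp_all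
  show "normalized_gf [2, 0, 0, 0] s = normalized_gf [1, 1, 0, 0] (s + 1)"
    by (subst normalized_gf_def, subst cyl_gf_2000, subst normalized_bounded_gf) simp_all
  show "normalized_gf [1, 1, 0, 0] s = normalized_gf [2, 0, 0, 0] (s + 1)
      + normalized_gf [1, 0, 1, 0] (s + 1) - (1 - q ^ (s + 1)) * normalized_gf [1, 1, 0, 0] (s + 2)"
    by (subst normalized_gf_def, subst cyl_gf_1100)
      (simp only: distrib_left right_diff_distrib normalized_bounded_gf rot list.size zero_less_Suc add_Suc_right)
  show "normalized_gf [1, 0, 1, 0] s = 2 * normalized_gf [1, 1, 0, 0] (s + 1)
      - (1 - q ^ (s + 1)) * normalized_gf [1, 0, 1, 0] (s + 2)"
    by (subst normalized_gf_def, subst cyl_gf_1010)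
      (simp only: distrib_left right_diff_distrib normalized_bounded_gf rot list.size zero_less_Suc add_Suc_right mult_2)
qed

lemma normalized_gf_recurrence:
  fixes s :: nat
  defines "G \<equiv> normalized_gf [1, 0, 1, 0]"
  shows "G s = (1 + q ^ (s + 1) + q ^ (s + 2)) * G (s + 2) + q ^ (s + 2) * (1 - q ^ (s + 3)) * G (s + 4)"
proof -
  define B where "B = normalized_gf [1, 1, 0, 0]"
  \<comment> \<open>Inserting the first equation into the second leaves the coefficient
    \<open>1 - (1 - q ^ (t + 1))\<close> at \<open>B (t + 2)\<close>.\<close>
  have B: "B t = q ^ (t + 1) * B (t + 2) + G (t + 1)" for t
    using normalized_gf_system(2)[of t] normalized_gf_system(1)[of "t + 1"]
    unfolding B_def G_def by (simp add: algebra_simps)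
  have G: "G t = 2 * B (t + 1) - (1 - q ^ (t + 1)) * G (t + 2)" for t
    using normalized_gf_system(3)[of t] unfolding B_def G_def .
  \<comment> \<open>\<open>B\<close> is eliminated in the form \<open>2 * B\<close>, the only one in
    which it enters \<open>G\<close>; the equation for \<open>G (s + 2)\<close> then provides
    \<open>2 * B (s + 3)\<close>.\<close>
  have "2 * B (s + 1) = q ^ (s + 2) * (2 * B (s + 3)) + 2 * G (s + 2)"
    using B[of "s + 1"] by (simp add: algebra_simps numeral_3_eq_3)
  moreover have "2 * B (s + 3) = G (s + 2) + (1 - q ^ (s + 3)) * G (s + 4)"
    using G[of "s + 2"] by (simp add: algebra_simps eval_nat_numeral)
  ultimately show ?thesis
    unfolding G[of s] by (simp only:) (simp only: ring_distribs mult_1 mult_2 mult.assoc, simp)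
qed

theorem theorem5p5:
  fixes q :: "rat fps"
  defines "q \<equiv> fps_X"
  shows "((\<lambda>\<Lambda>. q ^ cyl_size \<Lambda>) has_sum
           ((1 + (\<Sum>\<^sub>\<infinity>n\<in>{1..}.
                    2 * q ^ (n * (n + 1)) * qpoch (- (q\<^sup>2)) (q\<^sup>2) (n - 1) /
                      (qpoch (q\<^sup>2) (q\<^sup>2) n * qpoch (- q) (q\<^sup>2) n)))
             * (qpoch_inf (- q) (q\<^sup>2) / qpoch_inf q q)))
         (cylindric_partitions [1, 0, 1, 0])"
proof -
  let ?G = "normalized_gf [1, 0, 1, 0]"
  \<comment> \<open>The fixed variable \<open>q\<close> of the theorem hides the abbreviation, hence
    \<open>fps_X\<close>. The congruence follows from
    \<open>x * y - 1 = x * (y - 1) + (x - 1)\<close>.\<close>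
  have dvd: "fps_X ^ s dvd ?G s - 1" for s
  proof -
    have "fps_X ^ s dvd qpoch_inf (fps_X ^ (s + 1)) (fps_X :: rat fps) - 1"
      by (rule fps_X_power_dvd_qpoch_inf_minus_1) (simp_all add: le_imp_power_dvd)
    moreover have "fps_X ^ s dvd cyl_gf [1, 0, 1, 0] s - 1"
      by (rule fps_X_power_dvd_cyl_gf) simp
    moreover have "?G s - 1 = qpoch_inf (fps_X ^ (s + 1)) fps_X * (cyl_gf [1, 0, 1, 0] s - 1)
        + (qpoch_inf (fps_X ^ (s + 1)) fps_X - 1)"
      by (simp add: normalized_gf_def algebra_simps)
    ultimately show ?thesis
      by (metis dvd_add dvd_mult)
  qed
  have "?G 0 = series_solution 0"
    by (rule q_difference_equation_unique[OF normalized_gf_recurrence series_solution_recurrence dvd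
          fps_X_power_dvd_series_solution])
  then have eq: "qpoch_inf q q * cyl_gf [1, 0, 1, 0] 0 = series_solution 0"
    by (simp add: normalized_gf_def q_def)
  \<comment> \<open>Constant term 1 makes the prefactor invertible, so that it can be divided
    out.\<close>
  have unit: "fps_nth (qpoch_inf q q) 0 \<noteq> 0"
    by (subst qpoch_inf_nth_0) (simp_all add: q_def)
  have "cyl_gf [1, 0, 1, 0] 0 = inverse (qpoch_inf q q) * qpoch_inf q q * cyl_gf [1, 0, 1, 0] 0"
    by (simp add: inverse_mult_eq_1[OF unit])
  also have "\<dots> = series_solution 0 * inverse (qpoch_inf q q)"
    unfolding mult.assoc eq by (rule mult.commute)
  finally have "cyl_gf [1, 0, 1, 0] 0 = series_solution 0 * inverse (qpoch_inf q q)" .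
  then have *: "cyl_gf [1, 0, 1, 0] 0 = (1 + (\<Sum>\<^sub>\<infinity>n\<in>{1..}.
                    2 * q ^ (n * (n + 1)) * qpoch (- (q\<^sup>2)) (q\<^sup>2) (n - 1) /
                      (qpoch (q\<^sup>2) (q\<^sup>2) n * qpoch (- q) (q\<^sup>2) n)))
             * (qpoch_inf (- q) (q\<^sup>2) / qpoch_inf q q)"
    unfolding fps_divide_unit[OF unit] unfolding series_solution_0 q_def by (simp only: mult.assoc)
  have "((\<lambda>\<Lambda>. q ^ cyl_size \<Lambda>) has_sum cyl_gf [1, 0, 1, 0] 0) (cylindric_partitions [1, 0, 1, 0])"
    using has_sum_infsum[OF cyl_gf_summable[of _ "[1, 0, 1, 0]" 0, OF order_refl]]
    by (simp add: cyl_gf_def q_def)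
  then show ?thesis
    unfolding * .
qed

end
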